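(* Let $(\mathfrak g,\varphi,\xi,\eta)$ be an almost contact Lie algebra with abelian structure, such that $\mathfrak h=\operatorname{Ker}\eta$ is a subalgebra. Then $\mathfrak g$ is the semidirect product $\mathfrak g=\mathbb R\xi\ltimes_D\mathfrak h$, where the derivation $D:=\mathrm{ad}_\xi:\mathfrak h\to\mathfrak h$ commutes with the abelian complex structure $J=\varphi|_{\mathfrak h}$. Conversely, if $\mathfrak h$ is any Lie algebra endowed with an abelian complex structure $J$ and a derivation $D$ commuting with $J$, then $\mathfrak g:=\mathbb R\ltimes_D\mathfrak h$ admits an abelian almost contact structure.
   Context: An almost contact Lie algebra is a real Lie algebra $\mathfrak g$ of dimension $2n+1$ with $(\varphi,\xi,\eta)$, $\varphi\in\mathrm{End}(\mathfrak g)$, $\xi\in\mathfrak g$, $\eta\in\mathfrak g^*$, such that $\varphi^2=-I+\eta\otimes\xi$ and $\eta(\xi)=1$ (hence $\varphi\xi=0$, $\eta\circ\varphi=0$). The structure is abelian if $\mathrm{ad}_\xi\circ\varphi=\varphi\circ\mathrm{ad}_\xi$ and $[\varphi X,\varphi Y]=[X,Y]$ for all $X,Y\in\operatorname{Ker}\eta$. An abelian complex structure on a real Lie algebra $\mathfrak h$ is $J\in\mathrm{End}(\mathfrak h)$ with $J^2=-I$ and $[JX,JY]=[X,Y]$ for all $X,Y$. For a derivation $D$ of $\mathfrak h$, $\mathbb R\xi\ltimes_D\mathfrak h$ is the Lie algebra $\mathbb R\xi\oplus\mathfrak h$ in which $\mathfrak h$ is an ideal with its given bracket and $[\xi,X]=DX$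 for $X\in\mathfrak h$.
   Formalization: In the converse, the Lie algebra h is assumed finite-dimensional; for infinite-dimensional h the semidirect product cannot have dimension 2n+1, so it cannot be an almost contact Lie algebra. *)

theory Defs
  imports "HOL-Analysis.Product_Vector"
begin

text \<open>
  A real Lie algebra is a linear subspace \<open>L\<close> of some type of class \<open>real_vector\<close> together with a
  bracket that is only constrained on \<open>L\<close>. Explicit carriers are used, rather than whole types, so
  that the kernel of a linear form on \<open>L\<close> is again such an object.
\<close>

definition linear_map_on ::
    "'a::real_vector set \<Rightarrow> 'b::real_vector set \<Rightarrow> ('a \<Rightarrow> 'b) \<Rightarrow> bool" where
  "linear_map_on V W f \<longleftrightarrow>
     (\<forall>x\<in>V. f x \<in> W) \<and>
     (\<forall>x\<in>V. \<forall>y\<in>V. f (x + y) = f x + f y) \<and>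
     (\<forall>c. \<forall>x\<in>V. f (c *\<^sub>R x) = c *\<^sub>R f x)"

definition finite_dim :: "'a::real_vector set \<Rightarrow> bool" where
  "finite_dim V \<longleftrightarrow> (\<exists>B. finite B \<and> span B = V)"

locale lie_algebra =
  fixes L :: "'a::real_vector set" and br :: "'a \<Rightarrow> 'a \<Rightarrow> 'a"
  assumes subspace_carrier: "subspace L"
    and linear_left: "y \<in> L \<Longrightarrow> linear_map_on L L (\<lambda>x. br x y)"
    and linear_right: "x \<in> L \<Longrightarrow> linear_map_on L L (\<lambda>y. br x y)"
    and alternating: "x \<in> L \<Longrightarrow> br x x = 0"
    and jacobi: "\<lbrakk>x \<in> L; y \<in> L; z \<in> L\<rbrakk> \<Longrightarrow>
                   br x (br y z) + br y (br z x) + br z (br x y) = 0"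

definition lie_subalgebra ::
    "'a::real_vector set \<Rightarrow> 'a set \<Rightarrow> ('a \<Rightarrow> 'a \<Rightarrow> 'a) \<Rightarrow> bool" where
  "lie_subalgebra H L br \<longleftrightarrow>
     H \<subseteq> L \<and> subspace H \<and> (\<forall>x\<in>H. \<forall>y\<in>H. br x y \<in> H)"

definition lie_ideal ::
    "'a::real_vector set \<Rightarrow> 'a set \<Rightarrow> ('a \<Rightarrow> 'a \<Rightarrow> 'a) \<Rightarrow> bool" where
  "lie_ideal H L br \<longleftrightarrow>
     H \<subseteq> L \<and> subspace H \<and> (\<forall>x\<in>L. \<forall>y\<in>H. br x y \<in> H)"

definition lie_isomorphism ::
    "'a::real_vector set \<Rightarrow> ('a \<Rightarrow> 'a \<Rightarrow> 'a) \<Rightarrow>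
     'b::real_vector set \<Rightarrow> ('b \<Rightarrow> 'b \<Rightarrow> 'b) \<Rightarrow> ('a \<Rightarrow> 'b) \<Rightarrow> bool" where
  "lie_isomorphism L br L' br' f \<longleftrightarrow>
     lie_algebra L br \<and> lie_algebra L' br' \<and>
     linear_map_on L L' f \<and> bij_betw f L L' \<and>
     (\<forall>x\<in>L. \<forall>y\<in>L. f (br x y) = br' (f x) (f y))"

locale lie_derivation = lie_algebra L br
    for L :: "'a::real_vector set" and br :: "'a \<Rightarrow> 'a \<Rightarrow> 'a" +
  fixes D :: "'a \<Rightarrow> 'a"
  assumes linear_derivation: "linear_map_on L L D"
    and leibniz: "\<lbrakk>x \<in> L; y \<in> L\<rbrakk> \<Longrightarrow> D (br x y) = br (D x) y + br x (D y)"

locale abelian_complex_structure = lie_algebra L br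
    for L :: "'a::real_vector set" and br :: "'a \<Rightarrow> 'a \<Rightarrow> 'a" +
  fixes J :: "'a \<Rightarrow> 'a"
  assumes linear_J: "linear_map_on L L J"
    and J_squared: "x \<in> L \<Longrightarrow> J (J x) = - x"
    and abelian_J: "\<lbrakk>x \<in> L; y \<in> L\<rbrakk> \<Longrightarrow> br (J x) (J y) = br x y"

definition ker_on :: "'a::real_vector set \<Rightarrow> ('a \<Rightarrow> real) \<Rightarrow> 'a set" where
  "ker_on L \<eta> = {x \<in> L. \<eta> x = 0}"

text \<open>
  The dimension of an infinite-dimensional space is \<open>0\<close> by convention, so \<open>odd_dimension\<close> below
  entails that the Lie algebra is finite-dimensional.
\<close>

locale almost_contact_lie_algebra = lie_algebra L br
    for L :: "'a::real_vector set" and br :: "'a \<Rightarrow> 'a \<Rightarrow> 'a" +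
  fixes \<phi> :: "'a \<Rightarrow> 'a" and \<xi> :: 'a and \<eta> :: "'a \<Rightarrow> real"
  assumes odd_dimension: "\<exists>n. dim L = 2 * n + 1"
    and linear_phi: "linear_map_on L L \<phi>"
    and xi_carrier: "\<xi> \<in> L"
    and linear_eta: "linear_map_on L UNIV \<eta>"
    and phi_squared: "x \<in> L \<Longrightarrow> \<phi> (\<phi> x) = - x + \<eta> x *\<^sub>R \<xi>"
    and eta_xi: "\<eta> \<xi> = 1"

locale abelian_almost_contact_lie_algebra = almost_contact_lie_algebra +
  assumes ad_xi_phi: "x \<in> L \<Longrightarrow> br \<xi> (\<phi> x) = \<phi> (br \<xi> x)"
    and abelian_phi: "\<lbrakk>x \<in> ker_on L \<eta>; y \<in> ker_on L \<eta>\<rbrakk> \<Longrightarrow> br (\<phi> x) (\<phi> y) = br x y"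

text \<open>
  The semidirect product of the line with \<open>H\<close> along \<open>D\<close>. The pair \<open>(t, X)\<close> stands for
  \<open>t\<xi> + X\<close>, and the bracket is the bilinear alternating extension of the bracket of \<open>H\<close> and
  \<open>[\<xi>, X] = D X\<close>.
\<close>

definition semidirect_carrier :: "'a::real_vector set \<Rightarrow> (real \<times> 'a) set" where
  "semidirect_carrier H = UNIV \<times> H"

definition semidirect_bracket ::
    "('a::real_vector \<Rightarrow> 'a \<Rightarrow> 'a) \<Rightarrow> ('a \<Rightarrow> 'a) \<Rightarrow> real \<times> 'a \<Rightarrow> real \<times> 'a \<Rightarrow> real \<times> 'a" where
  "semidirect_bracket br D p q =
     (0, fst p *\<^sub>R D (snd q) - fst q *\<^sub>R D (snd p) + br (snd p) (snd q))"

end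

theory Submission
  imports Defs
begin

text \<open>
  From \<open>\<phi>\<^sup>2 = -I + \<eta> \<otimes> \<xi>\<close> one gets \<open>\<phi> \<xi> = 0\<close> and \<open>\<eta> \<circ> \<phi> = 0\<close>. Since \<open>ad \<xi>\<close> commutes with \<open>\<phi>\<close>, and
  \<open>X = - \<phi> (\<phi> X)\<close> on the kernel of \<open>\<eta>\<close>, the map \<open>ad \<xi>\<close> takes the kernel into the range of \<open>\<phi>\<close>, hence
  into the kernel; together with the splitting \<open>x = \<eta> x \<xi> + (x - \<eta> x \<xi>)\<close> this gives the semidirect
  product. For the converse take \<open>\<phi> (t, X) = (0, J X)\<close>, \<open>\<xi> = (1, 0)\<close>, \<open>\<eta> (t, X) = t\<close>; the dimension is
  odd because a finite-dimensional space with a complex structure has even dimension.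
\<close>

section \<open>Maps that are linear on a subspace only\<close>

lemma linear_map_onI:
  assumes "\<And>x. x \<in> V \<Longrightarrow> f x \<in> W"
    and "\<And>x y. x \<in> V \<Longrightarrow> y \<in> V \<Longrightarrow> f (x + y) = f x + f y"
    and "\<And>c x. x \<in> V \<Longrightarrow> f (c *\<^sub>R x) = c *\<^sub>R f x"
  shows "linear_map_on V W f"
  using assms by (simp add: linear_map_on_def)

context
  fixes V :: "'a::real_vector set" and W :: "'b::real_vector set" and f :: "'a \<Rightarrow> 'b"
  assumes f: "linear_map_on V W f"
begin

lemma linear_map_on_mem: "x \<in> V \<Longrightarrow> f x \<in> W"
  and linear_map_on_add: "x \<in> V \<Longrightarrow> y \<in> V \<Longrightarrow> f (x + y) = f x + f y"
  and linear_map_on_scale: "x \<in> V \<Longrightarrow> f (c *\<^sub>R x) = c *\<^sub>R f x"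
  using f by (auto simp: linear_map_on_def)

lemma linear_map_on_minus: "x \<in> V \<Longrightarrow> f (- x) = - f x"
  using linear_map_on_scale[of x "-1"] by simp

lemma linear_map_on_diff:
  assumes "subspace V" "x \<in> V" "y \<in> V"
  shows "f (x - y) = f x - f y"
  using linear_map_on_add[of x "- y"] linear_map_on_minus[of y] assms
  by (simp add: subspace_neg)

lemma linear_map_on_zero: "subspace V \<Longrightarrow> f 0 = 0"
  using linear_map_on_scale[of 0 0] by (simp add: subspace_0)

end

section \<open>Bilinearity of the bracket and subalgebras\<close>

context lie_algebra
begin

lemmas closed_simps [simp] =
  subspace_0[OF subspace_carrier] subspace_add[OF subspace_carrier]
  subspace_diff[OF subspace_carrier] subspace_neg[OF subspace_carrier]
  subspace_scale[OF subspace_carrier]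

lemma br_closed [simp]: "x \<in> L \<Longrightarrow> y \<in> L \<Longrightarrow> br x y \<in> L"
  using linear_map_on_mem[OF linear_left] by blast

lemma br_left:
  assumes "z \<in> L" "x \<in> L"
  shows "y \<in> L \<Longrightarrow> br (x + y) z = br x z + br y z"
    and "y \<in> L \<Longrightarrow> br (x - y) z = br x z - br y z"
    and "br (c *\<^sub>R x) z = c *\<^sub>R br x z"
    and "br (- x) z = - br x z"
  using linear_map_on_add[OF linear_left[OF assms(1)] assms(2)]
    linear_map_on_diff[OF linear_left[OF assms(1)] subspace_carrier assms(2)]
    linear_map_on_scale[OF linear_left[OF assms(1)] assms(2)]
    linear_map_on_minus[OF linear_left[OF assms(1)] assms(2)]
  by auto

lemma br_right:
  assumes "z \<in> L" "x \<in> L"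
  shows "y \<in> L \<Longrightarrow> br z (x + y) = br z x + br z y"
    and "y \<in> L \<Longrightarrow> br z (x - y) = br z x - br z y"
    and "br z (c *\<^sub>R x) = c *\<^sub>R br z x"
    and "br z (- x) = - br z x"
  using linear_map_on_add[OF linear_right[OF assms(1)] assms(2)]
    linear_map_on_diff[OF linear_right[OF assms(1)] subspace_carrier assms(2)]
    linear_map_on_scale[OF linear_right[OF assms(1)] assms(2)]
    linear_map_on_minus[OF linear_right[OF assms(1)] assms(2)]
  by auto

lemmas br_simps = br_left br_right

lemma br_zero:
  assumes "x \<in> L"
  shows "br 0 x = 0" "br x 0 = 0"
  using linear_map_on_zero[OF linear_left[OF assms] subspace_carrier]
    linear_map_on_zero[OF linear_right[OF assms] subspace_carrier] by auto

lemma anticommute: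
  assumes "x \<in> L" "y \<in> L"
  shows "br x y = - br y x"
proof -
  have "0 = br (x + y) (x + y)"
    using assms by (simp add: alternating)
  also have "\<dots> = br x x + br x y + (br y x + br y y)"
    using assms by (simp add: br_simps)
  finally show ?thesis
    using assms by (simp add: alternating eq_neg_iff_add_eq_0)
qed

lemma lie_subalgebra_lie_algebra:
  assumes "lie_subalgebra H L br"
  shows "lie_algebra H br"
proof
  have H: "H \<subseteq> L" "subspace H" "\<And>x y. x \<in> H \<Longrightarrow> y \<in> H \<Longrightarrow> br x y \<in> H"
    using assms by (auto simp: lie_subalgebra_def)
  show "subspace H" by fact
  show "linear_map_on H H (\<lambda>x. br x y)" if "y \<in> H" for y
    using that H by (intro linear_map_onI) (auto intro!: br_simps)
  show "linear_map_on H H (\<lambda>y. br x y)" if "x \<in> H" for x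
    using that H by (intro linear_map_onI) (auto intro!: br_simps)
  show "br x x = 0" if "x \<in> H" for x
    using that H by (auto intro: alternating)
  show "br x (br y z) + br y (br z x) + br z (br x y) = 0" if "x \<in> H" "y \<in> H" "z \<in> H" for x y z
    using that H by (auto intro: jacobi)
qed

end

section \<open>The semidirect product of a line with a Lie algebra along a derivation\<close>

lemma (in lie_derivation) semidirect_lie_algebra:
  "lie_algebra (semidirect_carrier L) (semidirect_bracket br D)"
proof
  note D_mem [simp] = linear_map_on_mem[OF linear_derivation]
  note D_simps = linear_map_on_add[OF linear_derivation] linear_map_on_scale[OF linear_derivation]
    linear_map_on_diff[OF linear_derivation subspace_carrier]
  show "subspace (semidirect_carrier L)"
    unfolding semidirect_carrier_def by (auto simp: subspace_def zero_prod_def)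
  show "linear_map_on (semidirect_carrier L) (semidirect_carrier L) (\<lambda>p. semidirect_bracket br D p q)"
    if "q \<in> semidirect_carrier L" for q
    using that
    by (intro linear_map_onI)
      (auto simp: semidirect_carrier_def semidirect_bracket_def D_simps br_simps algebra_simps)
  show "linear_map_on (semidirect_carrier L) (semidirect_carrier L) (\<lambda>q. semidirect_bracket br D p q)"
    if "p \<in> semidirect_carrier L" for p
    using that
    by (intro linear_map_onI)
      (auto simp: semidirect_carrier_def semidirect_bracket_def D_simps br_simps algebra_simps)
  show "semidirect_bracket br D p p = 0" if "p \<in> semidirect_carrier L" for p
    using that by (auto simp: semidirect_carrier_def semidirect_bracket_def alternating zero_prod_def)
  show "semidirect_bracket br D p (semidirect_bracket br D q r)
      + semidirect_bracket br D q (semidirect_bracket br D r p)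
      + semidirect_bracket br D r (semidirect_bracket br D p q) = 0"
    if "p \<in> semidirect_carrier L" "q \<in> semidirect_carrier L" "r \<in> semidirect_carrier L" for p q r
  proof -
    obtain a b c x y z where eq: "p = (a, x)" "q = (b, y)" "r = (c, z)"
      by (metis surj_pair)
    have mem [simp]: "x \<in> L" "y \<in> L" "z \<in> L"
      using that by (auto simp: eq semidirect_carrier_def)
    \<comment> \<open>In the cyclic sum the terms with D applied twice cancel in pairs. The
      coefficient of \<open>a\<close> is D[y,z] - [y,Dz] + [z,Dy], which vanishes by Leibniz and
      [Dy,z] = -[z,Dy]; those of \<open>b\<close> and \<open>c\<close> are analogous. What remains
      is the Jacobi identity for x, y, z.\<close>
    have "br (D x) y = - br y (D x)" "br (D y) z = - br z (D y)" "br (D z) x = - br x (D z)"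
      by (rule anticommute; simp)+
    moreover have "br x (br y z) + (br y (br z x) + br z (br x y)) = 0"
      using jacobi[of x y z] by (simp add: add.assoc)
    ultimately show ?thesis
      by (simp add: eq semidirect_bracket_def D_simps br_simps leibniz zero_prod_def algebra_simps)
  qed
qed

section \<open>Consequences of the almost contact axioms\<close>

context almost_contact_lie_algebra
begin

lemma xi_nonzero: "\<xi> \<noteq> 0"
  using eta_xi linear_map_on_zero[OF linear_eta subspace_carrier] by auto

lemma phi_closed [simp]: "x \<in> L \<Longrightarrow> \<phi> x \<in> L"
  by (rule linear_map_on_mem[OF linear_phi])

text \<open>The formula for \<phi> squared first gives \<phi>(\<phi> \<xi>) = 0. Applied next to
  \<phi> \<xi>, it shows \<phi> \<xi> = a \<xi> with a = \<eta>(\<phi> \<xi>). Applying \<phi> to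
  this equation gives 0 = a \<phi> \<xi>, so a = 0 or \<phi> \<xi> = 0, and either way \<phi> \<xi>
  = 0.\<close>

lemma phi_xi: "\<phi> \<xi> = 0"
proof -
  have sq: "\<phi> (\<phi> \<xi>) = 0"
    using phi_squared[OF xi_carrier] eta_xi by simp
  then have eigen: "\<phi> \<xi> = \<eta> (\<phi> \<xi>) *\<^sub>R \<xi>"
    using phi_squared[of "\<phi> \<xi>"] xi_carrier linear_map_on_zero[OF linear_phi subspace_carrier]
    by simp
  have "\<phi> (\<phi> \<xi>) = \<eta> (\<phi> \<xi>) *\<^sub>R \<phi> \<xi>"
    using arg_cong[OF eigen, of \<phi>] linear_map_on_scale[OF linear_phi xi_carrier] by simp
  then show ?thesis
    using sq eigen by auto
qed

text \<open>The cube of \<phi> at x is computed in two ways: \<phi> applied to \<phi>(\<phi> x)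
  gives -\<phi> x because \<phi> \<xi> = 0, while the square of \<phi> at \<phi> x gives the same
  vector plus \<eta>(\<phi> x) \<xi>. Since \<xi> is nonzero, the extra coefficient
  vanishes.\<close>

lemma eta_phi:
  assumes "x \<in> L"
  shows "\<eta> (\<phi> x) = 0"
proof -
  have "\<phi> (\<phi> (\<phi> x)) = - \<phi> x"
    using assms xi_carrier
    by (simp add: phi_squared[of x] linear_map_on_diff[OF linear_phi subspace_carrier]
        linear_map_on_scale[OF linear_phi] phi_xi)
  then show ?thesis
    using phi_squared[of "\<phi> x"] assms xi_nonzero by simp
qed

lemma subspace_ker: "subspace (ker_on L \<eta>)"
  by (auto simp: subspace_def ker_on_def linear_map_on_zero[OF linear_eta subspace_carrier]
      linear_map_on_add[OF linear_eta] linear_map_on_scale[OF linear_eta])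

lemma ker_projection: "x \<in> L \<Longrightarrow> x - \<eta> x *\<^sub>R \<xi> \<in> ker_on L \<eta>"
  using xi_carrier
  by (simp add: ker_on_def linear_map_on_diff[OF linear_eta subspace_carrier]
      linear_map_on_scale[OF linear_eta] eta_xi)

end

section \<open>The kernel of \<eta> as an ideal with derivation and complex structure\<close>

context abelian_almost_contact_lie_algebra
begin

lemma ad_xi_ker:
  assumes "x \<in> ker_on L \<eta>"
  shows "br \<xi> x \<in> ker_on L \<eta>"
proof -
  have x: "x \<in> L" "\<eta> x = 0"
    using assms by (auto simp: ker_on_def)
  have "br \<xi> x = br \<xi> (\<phi> (\<phi> (- x)))"
    using x phi_squared[of "- x"] by (simp add: linear_map_on_minus[OF linear_eta])
  also have "\<dots> = \<phi> (br \<xi> (\<phi> (- x)))"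
    using x by (intro ad_xi_phi) simp
  finally show ?thesis
    using x xi_carrier by (simp add: ker_on_def eta_phi)
qed

text \<open>Split x into its multiple of \<xi> and its kernel part. The first acts on the kernel by
  \<open>ad_xi_ker\<close>, the second by the subalgebra hypothesis.\<close>

lemma ker_lie_ideal:
  assumes "lie_subalgebra (ker_on L \<eta>) L br"
  shows "lie_ideal (ker_on L \<eta>) L br"
  unfolding lie_ideal_def
proof (intro conjI ballI)
  show "ker_on L \<eta> \<subseteq> L" "subspace (ker_on L \<eta>)"
    using assms by (auto simp: lie_subalgebra_def)
  fix x y assume x: "x \<in> L" and y: "y \<in> ker_on L \<eta>"
  have "y \<in> L"
    using y by (simp add: ker_on_def)
  have "br x y = br (\<eta> x *\<^sub>R \<xi> + (x - \<eta> x *\<^sub>R \<xi>)) y"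
    by simp
  also have "\<dots> = \<eta> x *\<^sub>R br \<xi> y + br (x - \<eta> x *\<^sub>R \<xi>) y"
    using x \<open>y \<in> L\<close> xi_carrier by (simp only: br_simps closed_simps)
  also have "\<dots> \<in> ker_on L \<eta>"
    using assms x y subspace_ker
    by (intro subspace_add subspace_scale)
      (auto simp: lie_subalgebra_def ad_xi_ker ker_projection)
  finally show "br x y \<in> ker_on L \<eta>" .
qed

lemma ker_lie_derivation:
  assumes "lie_subalgebra (ker_on L \<eta>) L br"
  shows "lie_derivation (ker_on L \<eta>) br (br \<xi>)"
proof -
  interpret H: lie_algebra "ker_on L \<eta>" br
    by (rule lie_subalgebra_lie_algebra[OF assms])
  show ?thesis
  proof
    show "linear_map_on (ker_on L \<eta>) (ker_on L \<eta>) (br \<xi>)"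
      using xi_carrier
      by (intro linear_map_onI ad_xi_ker) (auto simp: ker_on_def br_simps)
    fix x y assume "x \<in> ker_on L \<eta>" "y \<in> ker_on L \<eta>"
    then have xy: "x \<in> L" "y \<in> L"
      by (auto simp: ker_on_def)
    \<comment> \<open>Leibniz for ad \<xi> is the Jacobi identity for y, \<xi>, x. In this cyclic
      order [\<xi>,[x,y]] occurs with the right sign, and only the other two terms have to be turned
      around by anticommutativity.\<close>
    have "br y (br \<xi> x) = - br (br \<xi> x) y" "br x (br y \<xi>) = - br x (br \<xi> y)"
      "br y (br \<xi> x) + br \<xi> (br x y) + br x (br y \<xi>) = 0"
      using xy xi_carrier anticommute[of y "br \<xi> x"] anticommute[of y \<xi>] jacobi[of y \<xi> x]
      by (simp_all add: br_simps)
    then show "br \<xi> (br x y) = br (br \<xi> x) y + br x (br \<xi> y)"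
      by (simp add: algebra_simps)
  qed
qed

lemma semidirect_lie_isomorphism:
  assumes "lie_subalgebra (ker_on L \<eta>) L br"
  shows "lie_isomorphism (semidirect_carrier (ker_on L \<eta>)) (semidirect_bracket br (br \<xi>)) L br
      (\<lambda>(t, X). t *\<^sub>R \<xi> + X)"
proof -
  interpret H: lie_derivation "ker_on L \<eta>" br "br \<xi>"
    by (rule ker_lie_derivation[OF assms])
  have kerD: "x \<in> L \<and> \<eta> x = 0" if "x \<in> ker_on L \<eta>" for x
    using that by (simp add: ker_on_def)
  show ?thesis
    unfolding lie_isomorphism_def
  proof (intro conjI)
    show "lie_algebra (semidirect_carrier (ker_on L \<eta>)) (semidirect_bracket br (br \<xi>))"
      by (rule H.semidirect_lie_algebra)
    show "lie_algebra L br" ..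
    show "linear_map_on (semidirect_carrier (ker_on L \<eta>)) L (\<lambda>(t, X). t *\<^sub>R \<xi> + X)"
      using xi_carrier
      by (intro linear_map_onI) (auto simp: semidirect_carrier_def algebra_simps dest: kerD)
    \<comment> \<open>The inverse reads off the \<xi>-coordinate with \<eta> and keeps the kernel
      component, which is consistent because \<eta> \<xi> = 1.\<close>
    show "bij_betw (\<lambda>(t, X). t *\<^sub>R \<xi> + X) (semidirect_carrier (ker_on L \<eta>)) L"
      using xi_carrier
      by (intro bij_betw_byWitness[where f' = "\<lambda>x. (\<eta> x, x - \<eta> x *\<^sub>R \<xi>)"])
        (auto simp: semidirect_carrier_def ker_projection linear_map_on_add[OF linear_eta]
          linear_map_on_scale[OF linear_eta] eta_xi dest: kerD)
    show "\<forall>p\<in>semidirect_carrier (ker_on L \<eta>). \<forall>q\<in>semidirect_carrier (ker_on L \<eta>).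
        (case semidirect_bracket br (br \<xi>) p q of (t, X) \<Rightarrow> t *\<^sub>R \<xi> + X)
        = br (case p of (t, X) \<Rightarrow> t *\<^sub>R \<xi> + X) (case q of (t, X) \<Rightarrow> t *\<^sub>R \<xi> + X)"
    proof (intro ballI)
      fix p q
      assume "p \<in> semidirect_carrier (ker_on L \<eta>)" "q \<in> semidirect_carrier (ker_on L \<eta>)"
      then obtain a x b y where eq: "p = (a, x)" "q = (b, y)" and mem: "x \<in> L" "y \<in> L"
        using kerD by (auto simp: semidirect_carrier_def)
      \<comment> \<open>Expanding [a \<xi> + x, b \<xi> + y], the term ab [\<xi>,\<xi>] is zero and
        b [x,\<xi>] becomes -b [\<xi>,x], the source of the minus sign in
        \<open>semidirect_bracket\<close>.\<close>
      show "(case semidirect_bracket br (br \<xi>) p q of (t, X) \<Rightarrow> t *\<^sub>R \<xi> + X)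
          = br (case p of (t, X) \<Rightarrow> t *\<^sub>R \<xi> + X) (case q of (t, X) \<Rightarrow> t *\<^sub>R \<xi> + X)"
        using xi_carrier mem anticommute[of x \<xi>]
        by (simp add: eq semidirect_bracket_def br_simps alternating)
    qed
  qed
qed

text \<open>By \<open>eta_phi\<close> the kernel is stable under \<phi>, and on it the term \<eta> x
  \<xi> in the square of \<phi> disappears, leaving -x.\<close>

lemma ker_abelian_complex_structure:
  assumes "lie_subalgebra (ker_on L \<eta>) L br"
  shows "abelian_complex_structure (ker_on L \<eta>) br \<phi>"
proof -
  interpret H: lie_algebra "ker_on L \<eta>" br
    by (rule lie_subalgebra_lie_algebra[OF assms])
  show ?thesis
  proof
    show "linear_map_on (ker_on L \<eta>) (ker_on L \<eta>) \<phi>"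
      by (rule linear_map_onI)
        (auto simp: ker_on_def eta_phi linear_map_on_add[OF linear_phi]
          linear_map_on_scale[OF linear_phi])
    show "\<phi> (\<phi> x) = - x" if "x \<in> ker_on L \<eta>" for x
      using that phi_squared[of x] by (simp add: ker_on_def)
    show "br (\<phi> x) (\<phi> y) = br x y" if "x \<in> ker_on L \<eta>" "y \<in> ker_on L \<eta>" for x y
      using that by (rule abelian_phi)
  qed
qed

end

section \<open>Even dimension of a space with a complex structure\<close>

text \<open>The vectors of V that f sends into T form a subspace containing B. Keeping V in the
  picture matters since f is linear only there.\<close>

lemma linear_map_on_span:
  assumes f: "linear_map_on V W f" and V: "subspace V" and B: "B \<subseteq> V"
    and T: "subspace T" and fB: "\<And>b. b \<in> B \<Longrightarrow> f b \<in> T" and x: "x \<in> span B"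
  shows "f x \<in> T"
proof -
  have "subspace {x \<in> V. f x \<in> T}"
    using V T linear_map_on_zero[OF f V]
    by (auto simp: subspace_def linear_map_on_add[OF f] linear_map_on_scale[OF f])
  then have "span B \<subseteq> {x \<in> V. f x \<in> T}"
    using B fB by (intro span_minimal) auto
  then show ?thesis
    using x by auto
qed

text \<open>Starting from a finite spanning set, an independent family is grown by pairs c, J c, so
  its size stays even.\<close>

lemma complex_structure_even_basis:
  assumes V: "subspace V" and J: "linear_map_on V V J" and J2: "\<And>x. x \<in> V \<Longrightarrow> J (J x) = - x"
    and fin: "finite_dim V"
  obtains B where "finite B" "independent B" "span B = V" "even (card B)"
proof -
  obtain C where C: "finite C" "span C = V"
    using fin by (auto simp: finite_dim_def)
  \<comment> \<open>The induction runs over arbitrary finite subsets of V. Its invariant includes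
    that \<open>span B\<close> is stable under J, which is what forces J c to be new whenever c
    is.\<close>
  have "\<exists>B. finite B \<and> independent B \<and> B \<subseteq> V \<and> even (card B) \<and> J ` B \<subseteq> span B \<and> C \<subseteq> span B"
    if "finite C" "C \<subseteq> V" for C
    using that
  proof (induction C rule: finite_induct)
    case empty
    show ?case
      by (intro exI[of _ "{}"]) (auto simp: real_vector.independent_empty)
  next
    case (insert c C)
    then obtain B where B: "finite B" "independent B" "B \<subseteq> V" "even (card B)" "J ` B \<subseteq> span B"
      "C \<subseteq> span B"
      by auto
    have c: "c \<in> V"
      using insert.prems by auto
    show ?case
    proof (cases "c \<in> span B")
      case True
      then show ?thesis
        using B by (intro exI[of _ B]) auto
    next
      case False
      \<comment> \<open>Modulo \<open>span B\<close>, c would be an eigenvector of J with a real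
        eigenvalue k. Applying J and eliminating J c puts -(1 + k*k) c into \<open>span B\<close>;
        as 1 + k*k is positive, c itself would lie there.\<close>
      have Jc: "J c \<notin> span (insert c B)"
      proof
        assume "J c \<in> span (insert c B)"
        then obtain k where k: "J c - k *\<^sub>R c \<in> span B"
          by (auto simp: span_insert)
        have mem: "J c \<in> V"
          by (rule linear_map_on_mem[OF J c])
        have "J (J c - k *\<^sub>R c) \<in> span B"
          using B(5) by (intro linear_map_on_span[OF J V B(3) subspace_span _ k]) auto
        also have "J (J c - k *\<^sub>R c) = - c - k *\<^sub>R J c"
          using c mem V
          by (simp add: linear_map_on_diff[OF J V] linear_map_on_scale[OF J] subspace_scale J2)
        finally have "(- c - k *\<^sub>R J c) + k *\<^sub>R (J c - k *\<^sub>R c) \<in> span B"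
          using k by (intro span_add span_scale)
        also have "(- c - k *\<^sub>R J c) + k *\<^sub>R (J c - k *\<^sub>R c) = (- (1 + k * k)) *\<^sub>R c"
          by (simp add: algebra_simps)
        finally have "inverse (- (1 + k * k)) *\<^sub>R (- (1 + k * k)) *\<^sub>R c \<in> span B"
          by (rule span_scale)
        moreover have "- (1 + k * k) \<noteq> 0"
          using zero_le_square[of k] by linarith
        ultimately show False
          using False by simp
      qed
      \<comment> \<open>J sends the new vectors c and J c to J c and -c, so the enlarged span is
        again stable under J.\<close>
      define B' where "B' = insert (J c) (insert c B)"
      have sub: "span B \<subseteq> span B'"
        by (rule span_mono) (auto simp: B'_def)
      have notin: "c \<notin> B" "J c \<notin> insert c B"
        using False Jc span_base by blast+
      have "independent B'"
        unfolding B'_def using B(2) False Jc notin by (simp add: independent_insert)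
      moreover have "even (card B')"
        using B(1,4) notin by (simp add: B'_def)
      moreover have "J c \<in> span B'" "c \<in> span B'"
        by (auto simp: B'_def intro: span_base)
      then have "J ` B' \<subseteq> span B'" "insert c C \<subseteq> span B'"
        using B(5,6) sub c by (auto simp: B'_def J2 span_neg)
      ultimately show ?thesis
        using B(1,3) c linear_map_on_mem[OF J c]
        by (intro exI[of _ B']) (auto simp: B'_def)
    qed
  qed
  from this[of C] obtain B where B: "finite B" "independent B" "B \<subseteq> V" "even (card B)"
    "C \<subseteq> span B"
    using C span_base by blast
  have "span B = V"
    using B(3,5) C(2) V by (metis span_minimal span_span span_mono subset_antisym)
  then show ?thesis
    using that B by blast
qed

section \<open>The almost contact structure on a semidirect product\<close>

lemma dim_semidirect_carrier:
  assumes "finite B" "independent B" "span B = H"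
  shows "dim (semidirect_carrier H) = Suc (card B)"
proof -
  \<comment> \<open>A basis of the product: a copy of B in the second factor, and (1, 0) for the
    line, which lies outside the span of that copy because its first coordinate is 1.\<close>
  define A where "A = insert (1, 0) (Pair (0::real) ` B)"
  have lin: "linear (Pair (0::real) :: 'a \<Rightarrow> real \<times> 'a)"
    by (rule linearI) auto
  have span0: "span (Pair (0::real) ` B) = Pair 0 ` H"
    using linear_span_image[OF lin, of B] assms(3) by simp
  have "independent (Pair (0::real) ` B)"
    using lin assms(2) by (rule linear_independent_injective_image) (simp add: inj_on_def)
  then have indep: "independent A"
    by (auto simp: A_def independent_insert span0)
  have sub: "A \<subseteq> semidirect_carrier H"
    using assms(3) subspace_span[of B] span_base[of _ B] subspace_0
    by (auto simp: A_def semidirect_carrier_def)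
  have "(t, x) \<in> span A" if "x \<in> H" for t x
  proof -
    have "(0, x) \<in> span A"
      using that span0 span_mono[of "Pair 0 ` B" A] by (auto simp: A_def)
    then have "t *\<^sub>R (1, 0) + (0, x) \<in> span A"
      by (intro span_add span_scale) (auto simp: A_def intro: span_base)
    then show ?thesis
      by simp
  qed
  then have "semidirect_carrier H \<subseteq> span A"
    by (auto simp: semidirect_carrier_def)
  moreover have "card A = Suc (card B)"
    using assms(1) by (subst A_def, subst card_insert_disjoint) (auto simp: card_image inj_on_def)
  ultimately show ?thesis
    using real_vector.dim_unique[OF sub _ indep] by blast
qed

text \<open>The square of \<phi> sends (t, X) to (0, -X) = -(t, X) + t (1, 0). Finiteness of
  dimension serves to obtain a basis of H with an even number of elements; the line adds one
  more.\<close>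

lemma semidirect_abelian_almost_contact:
  assumes fin: "finite_dim H" and J: "abelian_complex_structure H br J"
    and D: "lie_derivation H br D" and DJ: "\<And>x. x \<in> H \<Longrightarrow> D (J x) = J (D x)"
  shows "abelian_almost_contact_lie_algebra (semidirect_carrier H) (semidirect_bracket br D)
      (\<lambda>p. (0, J (snd p))) (1, 0) fst"
proof -
  interpret abelian_complex_structure H br J by (rule J)
  interpret D: lie_derivation H br D by (rule D)
  interpret S: lie_algebra "semidirect_carrier H" "semidirect_bracket br D"
    by (rule D.semidirect_lie_algebra)
  note J_mem [simp] = linear_map_on_mem[OF linear_J]
  note D_zero = linear_map_on_zero[OF D.linear_derivation subspace_carrier]
  note J_zero = linear_map_on_zero[OF linear_J subspace_carrier]
  show ?thesis
  proof
    obtain B where B: "finite B" "independent B" "span B = H" "even (card B)"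
      using complex_structure_even_basis[OF subspace_carrier linear_J J_squared fin] by blast
    then show "\<exists>n. dim (semidirect_carrier H) = 2 * n + 1"
      by (auto simp: dim_semidirect_carrier elim: evenE)
    show "linear_map_on (semidirect_carrier H) (semidirect_carrier H) (\<lambda>p. (0, J (snd p)))"
      by (rule linear_map_onI)
        (auto simp: semidirect_carrier_def linear_map_on_add[OF linear_J]
          linear_map_on_scale[OF linear_J])
    show "(1, 0) \<in> semidirect_carrier H"
      by (simp add: semidirect_carrier_def)
    show "linear_map_on (semidirect_carrier H) UNIV fst"
      by (rule linear_map_onI) auto
    show "(0, J (snd (0, J (snd p)))) = - p + fst p *\<^sub>R (1, 0)" if "p \<in> semidirect_carrier H" for p
      using that by (auto simp: semidirect_carrier_def J_squared)
    show "fst (1, 0) = 1"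
      by simp
    \<comment> \<open>As (1, 0) has second component 0, the terms with \<open>D 0\<close> and
      \<open>br 0\<close> drop out. Thus ad \<xi> sends (t, X) to (0, D X), and the claim reduces to
      DJ = JD.\<close>
    show "semidirect_bracket br D (1, 0) (0, J (snd p))
        = (0, J (snd (semidirect_bracket br D (1, 0) p)))" if "p \<in> semidirect_carrier H" for p
      using that by (auto simp: semidirect_carrier_def semidirect_bracket_def DJ D_zero br_zero)
    \<comment> \<open>On the kernel both first coordinates are 0, so the D terms vanish and only the
      bracket of H is left.\<close>
    show "semidirect_bracket br D (0, J (snd p)) (0, J (snd q)) = semidirect_bracket br D p q"
      if "p \<in> ker_on (semidirect_carrier H) fst" "q \<in> ker_on (semidirect_carrier H) fst" for p q
      using that by (auto simp: ker_on_def semidirect_carrier_def semidirect_bracket_def abelian_J)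
  qed
qed

text \<open>The equality with the semidirect product is rendered by the explicit isomorphism (t, X)
  to t \<xi> + X. The converse assumes \<open>finite_dim\<close> because an almost contact Lie
  algebra has odd, hence finite, dimension.\<close>

theorem proposition3p11:
  fixes \<gg> :: "'a::real_vector set" and br :: "'a \<Rightarrow> 'a \<Rightarrow> 'a"
    and \<phi> :: "'a \<Rightarrow> 'a" and \<xi> :: 'a and \<eta> :: "'a \<Rightarrow> real"
    and \<hh> :: "'b::real_vector set" and brh :: "'b \<Rightarrow> 'b \<Rightarrow> 'b"
    and J D :: "'b \<Rightarrow> 'b"
  shows
    "(abelian_almost_contact_lie_algebra \<gg> br \<phi> \<xi> \<eta> \<and>
      lie_subalgebra (ker_on \<gg> \<eta>) \<gg> br \<longrightarrow>
        lie_ideal (ker_on \<gg> \<eta>) \<gg> br \<and>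
        lie_derivation (ker_on \<gg> \<eta>) br (br \<xi>) \<and>
        lie_isomorphism
          (semidirect_carrier (ker_on \<gg> \<eta>)) (semidirect_bracket br (br \<xi>))
          \<gg> br (\<lambda>(t, X). t *\<^sub>R \<xi> + X) \<and>
        abelian_complex_structure (ker_on \<gg> \<eta>) br \<phi> \<and>
        (\<forall>X \<in> ker_on \<gg> \<eta>. br \<xi> (\<phi> X) = \<phi> (br \<xi> X)))
     \<and>
     (finite_dim \<hh> \<and> abelian_complex_structure \<hh> brh J \<and> lie_derivation \<hh> brh D \<and>
      (\<forall>X \<in> \<hh>. D (J X) = J (D X)) \<longrightarrow>
        (\<exists>\<phi>' \<xi>' \<eta>'. abelian_almost_contact_lie_algebra
            (semidirect_carrier \<hh>) (semidirect_bracket brh D) \<phi>' \<xi>' \<eta>'))"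
proof (intro conjI impI)
  assume A: "abelian_almost_contact_lie_algebra \<gg> br \<phi> \<xi> \<eta> \<and> lie_subalgebra (ker_on \<gg> \<eta>) \<gg> br"
  then interpret abelian_almost_contact_lie_algebra \<gg> br \<phi> \<xi> \<eta>
    by blast
  note H = conjunct2[OF A]
  show "lie_ideal (ker_on \<gg> \<eta>) \<gg> br"
    by (rule ker_lie_ideal[OF H])
  show "lie_derivation (ker_on \<gg> \<eta>) br (br \<xi>)"
    by (rule ker_lie_derivation[OF H])
  show "lie_isomorphism (semidirect_carrier (ker_on \<gg> \<eta>)) (semidirect_bracket br (br \<xi>))
      \<gg> br (\<lambda>(t, X). t *\<^sub>R \<xi> + X)"
    by (rule semidirect_lie_isomorphism[OF H])
  show "abelian_complex_structure (ker_on \<gg> \<eta>) br \<phi>"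
    by (rule ker_abelian_complex_structure[OF H])
  show "\<forall>X \<in> ker_on \<gg> \<eta>. br \<xi> (\<phi> X) = \<phi> (br \<xi> X)"
    by (simp add: ker_on_def ad_xi_phi)
next
  assume "finite_dim \<hh> \<and> abelian_complex_structure \<hh> brh J \<and> lie_derivation \<hh> brh D \<and>
      (\<forall>X \<in> \<hh>. D (J X) = J (D X))"
  then show "\<exists>\<phi>' \<xi>' \<eta>'. abelian_almost_contact_lie_algebra
      (semidirect_carrier \<hh>) (semidirect_bracket brh D) \<phi>' \<xi>' \<eta>'"
    by (blast intro: semidirect_abelian_almost_contact)
qed

end
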